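(* Let $P(z)\in\mathbb{C}[z]$, $z=(z_1,\dots,z_n)$, and let $\Lambda=\Lambda(\partial)$ be a differential operator with constant coefficients, where $\Lambda(\xi)\in\mathbb{C}[\xi]$, $\xi=(\xi_1,\dots,\xi_n)$. Assume that $$(\mathrm{Poly}(P)-\mathrm{Poly}(\Lambda))\cap\mathbb{R}_{\ge 0}^n=\emptyset.$$ Then: (a) for every $m\ge 1$, $\Lambda^m(P^m)=0$; (b) for every $g(z)\in\mathbb{C}[z]$, there exists $N\ge 1$ such that $\Lambda^m(P^m g)=0$ for all $m\ge N$.
   Context: $\partial=(\partial_1,\dots,\partial_n)$ with $\partial_i=\partial/\partial z_i$, and $\Lambda(\partial)$ is obtained by substituting $\partial_i$ for $\xi_i$ in $\Lambda(\xi)$; $\Lambda^m$ is the $m$-fold composition. For a polynomial $P(z)$, $\mathrm{Supp}(P)$ is the set of exponents $\alpha\in\mathbb{N}^n$ such that the coefficient of $z^\alpha$ in $P$ is non-zero, and $\mathrm{Poly}(P)\subset\mathbb{R}^n$ is the convex hull of $\mathrm{Supp}(P)$. $\mathrm{Poly}(\Lambda)$ is defined to be the polytope $\mathrm{Poly}(\Lambda(\xi))$ of the polynomial $\Lambda(\xi)$. For $A,B\subset\mathbb{R}^n$, $A-B=\{u-v : u\in A, v\in B\}$. $\mathbb{R}_{\ge 0}^n$ is the set of vectors in $\mathbb{R}^n$ with all components non-negative. *)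

theory Defs
  imports "HOL-Analysis.Analysis" "HOL-Library.Poly_Mapping"
begin

(* The variables are indexed by a type 'n; the theorem takes it finite, so that n = CARD('n).
   An exponent alpha of N^n is a map 'n => nat (of finite support), a polynomial maps each
   exponent to its coefficient, and + , * , ^ on polynomials are the ring operations of
   Poly_Mapping (convolution product). *)

type_synonym 'n exponent = "'n \<Rightarrow>\<^sub>0 nat"
type_synonym 'n cpoly = "'n exponent \<Rightarrow>\<^sub>0 complex"

(* If alpha_i = 0, the exponent subtraction truncates, but the coefficient is then 0. *)

definition partial_deriv :: "'n \<Rightarrow> 'n cpoly \<Rightarrow> 'n cpoly" where
  "partial_deriv i p =
     (\<Sum>\<alpha>\<in>Poly_Mapping.keys p.
        Poly_Mapping.single (\<alpha> - Poly_Mapping.single i 1)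
          (of_nat (Poly_Mapping.lookup \<alpha> i) * Poly_Mapping.lookup p \<alpha>))"

lemma lookup_partial_deriv:
  "Poly_Mapping.lookup (partial_deriv i p) \<alpha> =
     of_nat (Suc (Poly_Mapping.lookup \<alpha> i)) * Poly_Mapping.lookup p (\<alpha> + Poly_Mapping.single i 1)"
proof -
  let ?e = "Poly_Mapping.single i (1::nat)"
  let ?c = "\<lambda>\<beta>. of_nat (Poly_Mapping.lookup \<beta> i) * Poly_Mapping.lookup p \<beta>"
  have shift: "\<beta> = \<alpha> + ?e" if "\<beta> - ?e = \<alpha>" "Poly_Mapping.lookup \<beta> i \<noteq> 0" for \<beta>
    using that by (intro poly_mapping_eqI)
      (auto simp: lookup_add lookup_minus lookup_single when_def)
  have "Poly_Mapping.lookup (partial_deriv i p) \<alpha>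
      = (\<Sum>\<beta>\<in>Poly_Mapping.keys p. if \<beta> - ?e = \<alpha> then ?c \<beta> else 0)"
    by (simp add: partial_deriv_def lookup_sum lookup_single when_def)
  also have "\<dots> = (\<Sum>\<beta>\<in>Poly_Mapping.keys p. if \<beta> = \<alpha> + ?e then ?c \<beta> else 0)"
    by (rule sum.cong) (use shift in auto)
  also have "\<dots> = ?c (\<alpha> + ?e)"
    by (simp add: sum.delta in_keys_iff)
  finally show ?thesis
    by (simp add: lookup_add)
qed

lemma partial_deriv_commute:
  "partial_deriv i (partial_deriv j p) = partial_deriv j (partial_deriv i p)"
  by (cases "i = j")
    (auto intro!: poly_mapping_eqI simp: lookup_partial_deriv lookup_add lookup_single ac_simps)

lemma partial_deriv_funpow_commute:
  "(partial_deriv i ^^ a) ((partial_deriv j ^^ b) p)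
     = (partial_deriv j ^^ b) ((partial_deriv i ^^ a) p)"
proof -
  have "partial_deriv i ((partial_deriv j ^^ b) p) = (partial_deriv j ^^ b) (partial_deriv i p)"
    for p b
    by (induction b) (simp_all, metis partial_deriv_commute)
  then show ?thesis
    by (induction a) simp_all
qed

(* The composition of the operators (d/dz_i)^(beta_i) over all i. *)

definition monomial_deriv :: "'n exponent \<Rightarrow> 'n cpoly \<Rightarrow> 'n cpoly" where
  "monomial_deriv \<beta> p =
     Finite_Set.fold (\<lambda>i. partial_deriv i ^^ Poly_Mapping.lookup \<beta> i) p UNIV"

(* These operators commute, so the fold depends on no order of the variables. *)

lemma comp_fun_commute_partial_deriv:
  "comp_fun_commute (\<lambda>i. partial_deriv i ^^ Poly_Mapping.lookup \<beta> i)"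
  by unfold_locales (simp add: fun_eq_iff partial_deriv_funpow_commute)

definition diff_op :: "'n cpoly \<Rightarrow> 'n cpoly \<Rightarrow> 'n cpoly" where
  "diff_op \<Lambda> p =
     (\<Sum>\<beta>\<in>Poly_Mapping.keys \<Lambda>.
        Poly_Mapping.single 0 (Poly_Mapping.lookup \<Lambda> \<beta>) * monomial_deriv \<beta> p)"

definition poly_supp :: "'n::finite cpoly \<Rightarrow> (real ^ 'n) set" where
  "poly_supp p = (\<lambda>\<alpha>. \<chi> i. real (Poly_Mapping.lookup \<alpha> i)) ` Poly_Mapping.keys p"

definition newton_polytope :: "'n::finite cpoly \<Rightarrow> (real ^ 'n) set" where
  "newton_polytope p = convex hull poly_supp p"

end

theory Submission
  imports Defs
begin

text \<open>
  An exponent of \<open>\<Lambda>\<^sup>m (P\<^sup>m g)\<close> has the form \<open>m (u - v) + \<delta>\<close> with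
  \<open>u \<in> Poly(P)\<close>, \<open>v \<in> Poly(\<Lambda>)\<close>, \<open>\<delta> \<in> Supp(g)\<close>. Dividing by \<open>m\<close> gives a point
  of the orthant at distance \<open>\<bar>\<delta>\<bar> / m\<close> from the compact set \<open>Poly(P) - Poly(\<Lambda>)\<close>. This set
  has positive distance to the orthant, so no such exponent exists if \<open>\<delta> = 0\<close> or \<open>m\<close> is large.
\<close>

text \<open>The embedding of exponents that \<open>poly_supp\<close> uses inline, named so that its
  additivity can be stated.\<close>

definition exponent_vec :: "'n::finite exponent \<Rightarrow> real ^ 'n" where
  "exponent_vec \<alpha> = (\<chi> i. real (Poly_Mapping.lookup \<alpha> i))"

lemma exponent_vec_zero [simp]: "exponent_vec 0 = 0"
  by (simp add: exponent_vec_def vec_eq_iff)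

lemma exponent_vec_add: "exponent_vec (\<alpha> + \<beta>) = exponent_vec \<alpha> + exponent_vec \<beta>"
  by (simp add: exponent_vec_def vec_eq_iff lookup_add)

lemma exponent_vec_in_newton_polytope:
  "\<alpha> \<in> Poly_Mapping.keys p \<Longrightarrow> exponent_vec \<alpha> \<in> newton_polytope p"
  by (auto simp: newton_polytope_def poly_supp_def exponent_vec_def intro!: hull_inc)

lemma convex_newton_polytope: "convex (newton_polytope p)"
  by (simp add: newton_polytope_def)

lemma compact_newton_polytope: "compact (newton_polytope p)"
  by (simp add: newton_polytope_def poly_supp_def finite_imp_compact_convex_hull)

text \<open>The weights \<open>Suc k / Suc (Suc k)\<close> and \<open>1 / Suc (Suc k)\<close> sum to
  1. This is the inductive step for the fact that a sum of n points of a convex set is n times one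
  of its points.\<close>

lemma convex_Suc_multiple:
  assumes "convex S" "u \<in> S" "v \<in> S"
  obtains w where "w \<in> S" "real (Suc k) *\<^sub>R u + v = real (Suc (Suc k)) *\<^sub>R w"
proof
  let ?n = "real (Suc (Suc k))"
  show "(real (Suc k) / ?n) *\<^sub>R u + (1 / ?n) *\<^sub>R v \<in> S"
    using assms by (intro convexD) (auto simp: field_simps)
  show "real (Suc k) *\<^sub>R u + v = ?n *\<^sub>R ((real (Suc k) / ?n) *\<^sub>R u + (1 / ?n) *\<^sub>R v)"
    by (simp add: scaleR_add_right)
qed

text \<open>By \<open>lookup_partial_deriv\<close>, each coefficient of a derivative is a multiple
  of the coefficient one step up in direction i, so it is nonzero only if that one is.\<close>

lemma keys_funpow_partial_deriv:
  "\<gamma> \<in> Poly_Mapping.keys ((partial_deriv i ^^ k) p)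
    \<Longrightarrow> \<gamma> + Poly_Mapping.single i k \<in> Poly_Mapping.keys p"
proof (induction k arbitrary: \<gamma>)
  case (Suc k)
  then have "\<gamma> + Poly_Mapping.single i 1 \<in> Poly_Mapping.keys ((partial_deriv i ^^ k) p)"
    by (auto simp: in_keys_iff lookup_partial_deriv)
  from Suc.IH[OF this] show ?case
    by (simp add: add.assoc flip: single_add)
qed simp

lemma keys_monomial_deriv:
  fixes p :: "'n::finite cpoly"
  assumes "\<gamma> \<in> Poly_Mapping.keys (monomial_deriv \<beta> p)"
  shows "\<gamma> + \<beta> \<in> Poly_Mapping.keys p"
proof -
  interpret comp_fun_commute "\<lambda>i::'n. partial_deriv i ^^ Poly_Mapping.lookup \<beta> i"
    by (rule comp_fun_commute_partial_deriv)
  let ?s = "\<lambda>i. Poly_Mapping.single i (Poly_Mapping.lookup \<beta> i)"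
  \<comment> \<open>The fold over \<open>UNIV\<close> is generalised to a finite set A for the
    induction. The exponent \<gamma> stays arbitrary because peeling off the operator of a variable
    shifts it.\<close>
  have "\<gamma> + (\<Sum>i\<in>A. ?s i) \<in> Poly_Mapping.keys p"
    if "finite A"
      "\<gamma> \<in> Poly_Mapping.keys (Finite_Set.fold (\<lambda>i. partial_deriv i ^^ Poly_Mapping.lookup \<beta> i) p A)"
    for A \<gamma>
    using that
  proof (induction A arbitrary: \<gamma> rule: finite_induct)
    case (insert i A)
    then have "\<gamma> + ?s i \<in> Poly_Mapping.keys
        (Finite_Set.fold (\<lambda>i. partial_deriv i ^^ Poly_Mapping.lookup \<beta> i) p A)"
      by (simp add: keys_funpow_partial_deriv)
    from insert.IH[OF this] insert.hyps show ?case
      by (simp add: add.assoc)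
  qed simp
  from this[OF finite, of \<gamma>] assms have "\<gamma> + (\<Sum>i\<in>UNIV. ?s i) \<in> Poly_Mapping.keys p"
    by (simp add: monomial_deriv_def)
  moreover have "(\<Sum>i\<in>UNIV. ?s i) = \<beta>"
    by (rule poly_mapping_eqI) (simp add: lookup_sum lookup_single when_def)
  ultimately show ?thesis
    by simp
qed

text \<open>Cancellation between the summands can only remove exponents, so each surviving one comes
  from a single monomial of \<Lambda>.\<close>

lemma keys_diff_op:
  fixes p \<Lambda> :: "'n::finite cpoly"
  assumes "\<gamma> \<in> Poly_Mapping.keys (diff_op \<Lambda> p)"
  obtains \<beta> where "\<beta> \<in> Poly_Mapping.keys \<Lambda>" "\<gamma> + \<beta> \<in> Poly_Mapping.keys p"
proof -
  obtain \<beta> where \<beta>: "\<beta> \<in> Poly_Mapping.keys \<Lambda>"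
    and "\<gamma> \<in> Poly_Mapping.keys
      (Poly_Mapping.single 0 (Poly_Mapping.lookup \<Lambda> \<beta>) * monomial_deriv \<beta> p)"
    using subsetD[OF keys_sum assms[unfolded diff_op_def]] by blast
  then obtain \<alpha> \<gamma>' where "\<gamma> = \<alpha> + \<gamma>'" "\<gamma>' \<in> Poly_Mapping.keys (monomial_deriv \<beta> p)"
    and "\<alpha> \<in> Poly_Mapping.keys (Poly_Mapping.single 0 (Poly_Mapping.lookup \<Lambda> \<beta>))"
    using subsetD[OF keys_mult] by blast
  then have "\<gamma> \<in> Poly_Mapping.keys (monomial_deriv \<beta> p)"
    by (auto split: if_splits)
  with \<beta> that show ?thesis
    using keys_monomial_deriv by blast
qed

text \<open>Each application shifts by one exponent of \<Lambda>, and v is the average of all the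
  shifts. Counting by \<open>Suc k\<close> excludes the zeroth iterate, for which no v exists if
  \<Lambda> = 0, the polytope then being empty.\<close>

lemma keys_funpow_diff_op:
  fixes p \<Lambda> :: "'n::finite cpoly"
  assumes "\<gamma> \<in> Poly_Mapping.keys ((diff_op \<Lambda> ^^ Suc k) p)"
  shows "\<exists>\<alpha>\<in>Poly_Mapping.keys p. \<exists>v\<in>newton_polytope \<Lambda>.
           exponent_vec \<gamma> + real (Suc k) *\<^sub>R v = exponent_vec \<alpha>"
  using assms
proof (induction k arbitrary: \<gamma>)
  case 0
  then obtain \<beta> where "\<beta> \<in> Poly_Mapping.keys \<Lambda>" "\<gamma> + \<beta> \<in> Poly_Mapping.keys p"
    by (auto elim: keys_diff_op)
  then show ?case
    by (intro bexI[of _ "\<gamma> + \<beta>"] bexI[of _ "exponent_vec \<beta>"])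
      (auto simp: exponent_vec_add exponent_vec_in_newton_polytope)
next
  case (Suc k)
  then obtain \<beta> where \<beta>: "\<beta> \<in> Poly_Mapping.keys \<Lambda>"
    and "\<gamma> + \<beta> \<in> Poly_Mapping.keys ((diff_op \<Lambda> ^^ Suc k) p)"
    by (auto elim: keys_diff_op)
  from Suc.IH[OF this(2)] obtain \<alpha> v where \<alpha>: "\<alpha> \<in> Poly_Mapping.keys p"
    and v: "v \<in> newton_polytope \<Lambda>"
    and eq: "exponent_vec (\<gamma> + \<beta>) + real (Suc k) *\<^sub>R v = exponent_vec \<alpha>"
    by blast
  \<comment> \<open>The new shift \<beta> is merged into the average v of the earlier ones.\<close>
  obtain w where w: "w \<in> newton_polytope \<Lambda>"
    "real (Suc k) *\<^sub>R v + exponent_vec \<beta> = real (Suc (Suc k)) *\<^sub>R w"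
    using convex_Suc_multiple[OF convex_newton_polytope v exponent_vec_in_newton_polytope[OF \<beta>]] .
  show ?case
    by (rule bexI[OF bexI[OF _ w(1)] \<alpha>])
      (simp only: eq[symmetric] w(2)[symmetric] exponent_vec_add add_ac)
qed

text \<open>An exponent of a power is a sum of exponents of the factors, and u is their average.
  Again \<open>Suc k\<close> matters: \<open>p ^ 0\<close> has the exponent 0 even if p = 0 has an
  empty polytope.\<close>

lemma keys_power:
  fixes p :: "'n::finite cpoly"
  assumes "\<alpha> \<in> Poly_Mapping.keys (p ^ Suc k)"
  shows "\<exists>u\<in>newton_polytope p. exponent_vec \<alpha> = real (Suc k) *\<^sub>R u"
  using assms
proof (induction k arbitrary: \<alpha>)
  case 0
  then show ?case
    by (intro bexI[of _ "exponent_vec \<alpha>"]) (simp_all add: exponent_vec_in_newton_polytope)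
next
  case (Suc k)
  then obtain \<beta> \<beta>' where \<beta>: "\<beta> \<in> Poly_Mapping.keys p"
    and "\<beta>' \<in> Poly_Mapping.keys (p ^ Suc k)" and \<alpha>: "\<alpha> = \<beta> + \<beta>'"
    using subsetD[OF keys_mult, of \<alpha> p "p ^ Suc k"] by auto
  from Suc.IH[OF this(2)] obtain u where u: "u \<in> newton_polytope p"
    and eq: "exponent_vec \<beta>' = real (Suc k) *\<^sub>R u"
    by blast
  obtain w where w: "w \<in> newton_polytope p"
    "real (Suc k) *\<^sub>R u + exponent_vec \<beta> = real (Suc (Suc k)) *\<^sub>R w"
    using convex_Suc_multiple[OF convex_newton_polytope u exponent_vec_in_newton_polytope[OF \<beta>]] .
  show ?case
    by (rule bexI[OF _ w(1)])
      (simp only: \<alpha> eq w(2)[symmetric] exponent_vec_add add_ac)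
qed

lemma keys_diff_op_power_mult:
  fixes P \<Lambda> g :: "'n::finite cpoly"
  assumes "1 \<le> m" "\<gamma> \<in> Poly_Mapping.keys ((diff_op \<Lambda> ^^ m) (P ^ m * g))"
  obtains u v \<delta> where "u \<in> newton_polytope P" "v \<in> newton_polytope \<Lambda>"
    "\<delta> \<in> Poly_Mapping.keys g" "exponent_vec \<gamma> = real m *\<^sub>R (u - v) + exponent_vec \<delta>"
proof -
  obtain k where m: "m = Suc k"
    using assms(1) by (cases m) auto
  obtain \<alpha> v where "\<alpha> \<in> Poly_Mapping.keys (P ^ m * g)" and v: "v \<in> newton_polytope \<Lambda>"
    and eq: "exponent_vec \<gamma> + real m *\<^sub>R v = exponent_vec \<alpha>"
    using keys_funpow_diff_op[OF assms(2)[unfolded m]] unfolding m by blast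
  then obtain \<alpha>' \<delta> where "\<alpha>' \<in> Poly_Mapping.keys (P ^ m)" and \<delta>: "\<delta> \<in> Poly_Mapping.keys g"
    and "\<alpha> = \<alpha>' + \<delta>"
    using subsetD[OF keys_mult] by blast
  moreover from this(1) obtain u where "u \<in> newton_polytope P" "exponent_vec \<alpha>' = real m *\<^sub>R u"
    using keys_power[of \<alpha>' P k] unfolding m by blast
  ultimately show ?thesis
    using that[of u v \<delta>] v eq by (simp add: exponent_vec_add algebra_simps)
qed

lemma closed_nonneg_orthant: "closed {x :: real ^ 'n::finite. \<forall>i. 0 \<le> x $ i}"
  by (intro closed_Collect_all closed_Collect_le continuous_intros)

theorem lemma4p9:
  fixes P \<Lambda> :: "'n::finite cpoly"
  assumes "{u - v | u v. u \<in> newton_polytope P \<and> v \<in> newton_polytope \<Lambda>} \<inter> {x :: real ^ 'n. \<forall>i. 0 \<le> x $ i} = {}"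
  shows "(\<forall>m\<ge>1. (diff_op \<Lambda> ^^ m) (P ^ m) = 0) \<and>
         (\<forall>g :: 'n cpoly. \<exists>N\<ge>1. \<forall>m\<ge>N. (diff_op \<Lambda> ^^ m) (P ^ m * g) = 0)"
proof -
  let ?D = "{u - v | u v. u \<in> newton_polytope P \<and> v \<in> newton_polytope \<Lambda>}"
  have "compact ?D"
    using compact_differences[OF compact_newton_polytope compact_newton_polytope] .
  then obtain d where d: "0 < d"
    and dist: "\<And>x y. x \<in> ?D \<Longrightarrow> (\<forall>i. 0 \<le> y $ i) \<Longrightarrow> d \<le> dist x y"
    using separate_compact_closed[OF _ closed_nonneg_orthant assms] by auto
  \<comment> \<open>Common core of both claims: the exponents of g are too short, relative to m, to
    bridge the gap d.\<close>
  have vanish: "(diff_op \<Lambda> ^^ m) (P ^ m * g) = 0"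
    if m: "1 \<le> m" and small: "\<And>\<delta>. \<delta> \<in> Poly_Mapping.keys g \<Longrightarrow> norm (exponent_vec \<delta>) < real m * d"
    for m g
  proof (rule ccontr)
    assume "(diff_op \<Lambda> ^^ m) (P ^ m * g) \<noteq> 0"
    then obtain \<gamma> where "\<gamma> \<in> Poly_Mapping.keys ((diff_op \<Lambda> ^^ m) (P ^ m * g))"
      by (meson all_not_in_conv keys_eq_empty)
    with m obtain u v \<delta> where uv: "u \<in> newton_polytope P" "v \<in> newton_polytope \<Lambda>"
      and \<delta>: "\<delta> \<in> Poly_Mapping.keys g"
      and eq: "exponent_vec \<gamma> = real m *\<^sub>R (u - v) + exponent_vec \<delta>"
      by (elim keys_diff_op_power_mult)
    \<comment> \<open>Scaling by 1/m keeps the exponent vector of \<gamma> in the orthant, and by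
      \<open>eq\<close> it then differs from u - v by exactly the vector of \<delta> divided by
      m.\<close>
    have "d \<le> dist (u - v) ((1 / real m) *\<^sub>R exponent_vec \<gamma>)"
      using uv by (intro dist) (auto simp: exponent_vec_def)
    also have "\<dots> = norm (exponent_vec \<delta>) / real m"
      using m by (simp add: eq dist_norm scaleR_add_right)
    finally show False
      using m small[OF \<delta>] by (simp add: field_simps)
  qed
  \<comment> \<open>For g = 1 the only exponent is 0, so the smallness condition reads 0 < m d and
    holds for every m \<ge> 1.\<close>
  have "(diff_op \<Lambda> ^^ m) (P ^ m) = 0" if "1 \<le> m" for m
    using vanish[of m 1] that d by simp
  moreover have "\<exists>N\<ge>1. \<forall>m\<ge>N. (diff_op \<Lambda> ^^ m) (P ^ m * g) = 0" for g
  proof -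
    \<comment> \<open>The sum bounds all the norms at once and, unlike a maximum, also makes sense
      for g = 0.\<close>
    let ?C = "\<Sum>\<delta>\<in>Poly_Mapping.keys g. norm (exponent_vec \<delta>)"
    obtain N where N: "?C < real N * d"
      using d reals_Archimedean3 by blast
    show ?thesis
    proof (intro exI[of _ "max 1 N"] conjI allI impI vanish)
      fix m \<delta> assume m: "max 1 N \<le> m" and "\<delta> \<in> Poly_Mapping.keys g"
      then have "norm (exponent_vec \<delta>) \<le> ?C"
        by (intro member_le_sum) auto
      also have "\<dots> < real N * d"
        by (rule N)
      also have "\<dots> \<le> real m * d"
        using m d by (intro mult_right_mono) auto
      finally show "norm (exponent_vec \<delta>) < real m * d" .
    qed auto
  qed
  ultimately show ?thesis
    by blast
qed

end
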